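(* Let $g:\mathcal{U}\times\mathcal{V}\times\mathcal{X}\to\mathbb{R}$ and $f:\mathcal{X}\to\mathbb{R}$ satisfy $\max_{u\in\mathcal{U},v\in\mathcal{V}}g(u,v,x)=f(x)$ for all $x\in\mathcal{X}$. Consider the cyclic block coordinate ascent iteration, $t=0,1,2,\dots$, $$u^{(t+1)}\in\arg\max_{u\in\mathcal{U}}g(u,v^{(t)},x^{(t)}),\quad v^{(t+1)}\in\arg\max_{v\in\mathcal{V}}g(u^{(t+1)},v,x^{(t)}),\quad x^{(t+1)}\in\arg\max_{x\in\mathcal{X}}g(u^{(t+1)},v^{(t+1)},x),$$ and suppose that the update of $u$ depends only on $x^{(t)}$ and not on $v^{(t)}$, i.e. $u^{(t+1)}=U(x^{(t)})$ for a map $U:\mathcal{X}\to\mathcal{U}$ with $U(x)\in\arg\max_{u\in\mathcal{U}}g(u,v,x)$ for every $v\in\mathcal{V}$ and every $x\in\mathcal{X}$. Then for every $t$, $$(u^{(t+1)},v^{(t+1)})\in\arg\max_{u\in\mathcal{U},v\in\mathcal{V}}g(u,v,x^{(t)}),$$ and the function $x\mapsto g(u^{(t+1)},v^{(t+1)},x)$ is a surrogate function of $f$ at $x^{(t)}$; that is, $g(u^{(t+1)},v^{(t+1)},x)\le f(x)$ for all $x\in\mathcal{X}$ and $g(u^{(t+1)},v^{(t+1)},x^{(t)})=f(x^{(t)})$. Consequently the iteration $x^{(t)}\mapsto x^{(t+1)}$ is a minorization-maximization iteration for maximizing $f$ over $\mathcal{X}$.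
   Context: $\mathcal{U},\mathcal{V},\mathcal{X}$ are the (nonempty) feasible sets of the three blocks $u,v,x$; all maxima appearing in the updates are assumed attained. A minorization-maximization iteration for $\max_{x\in\mathcal{X}}f(x)$ is an update $x^{(t+1)}\in\arg\max_{x\in\mathcal{X}}\ell(x,x^{(t)})$, where $\ell(\cdot,x^{(t)})$ is a surrogate function of $f$ at $x^{(t)}$, meaning $\ell(x,x^{(t)})\le f(x)$ for all $x\in\mathcal{X}$ and $\ell(x^{(t)},x^{(t)})=f(x^{(t)})$. *)

theory Defs
  imports Complex_Main
begin

definition argmax_set :: "('a \<Rightarrow> real) \<Rightarrow> 'a set \<Rightarrow> 'a set" where
  "argmax_set h S = {a. is_arg_max h (\<lambda>b. b \<in> S) a}"

text \<open>The maximum exists (is attained) and has value \<open>m\<close>.\<close>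

definition has_max :: "('a \<Rightarrow> real) \<Rightarrow> 'a set \<Rightarrow> real \<Rightarrow> bool" where
  "has_max h S m \<longleftrightarrow> (\<exists>a \<in> argmax_set h S. h a = m)"

text \<open>The value \<open>u 0\<close> is never read by the iteration, so only \<open>v 0\<close> and \<open>x 0\<close> are initial data.\<close>

definition block_coordinate_ascent ::
  "'u set \<Rightarrow> 'v set \<Rightarrow> 'x set \<Rightarrow> ('u \<Rightarrow> 'v \<Rightarrow> 'x \<Rightarrow> real)
    \<Rightarrow> (nat \<Rightarrow> 'u) \<Rightarrow> (nat \<Rightarrow> 'v) \<Rightarrow> (nat \<Rightarrow> 'x) \<Rightarrow> bool" where
  "block_coordinate_ascent \<U> \<V> \<X> g u v x \<longleftrightarrow>
     v 0 \<in> \<V> \<and> x 0 \<in> \<X> \<and>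
     (\<forall>t. u (Suc t) \<in> argmax_set (\<lambda>a. g a (v t) (x t)) \<U> \<and>
          v (Suc t) \<in> argmax_set (\<lambda>b. g (u (Suc t)) b (x t)) \<V> \<and>
          x (Suc t) \<in> argmax_set (\<lambda>y. g (u (Suc t)) (v (Suc t)) y) \<X>)"

definition surrogate_at :: "'x set \<Rightarrow> ('x \<Rightarrow> real) \<Rightarrow> ('x \<Rightarrow> real) \<Rightarrow> 'x \<Rightarrow> bool" where
  "surrogate_at \<X> f s z \<longleftrightarrow> (\<forall>y \<in> \<X>. s y \<le> f y) \<and> s z = f z"

text \<open>One minorization-maximization step from \<open>z\<close> to \<open>z'\<close> with surrogate \<open>s\<close>.\<close>

definition mm_update :: "'x set \<Rightarrow> ('x \<Rightarrow> real) \<Rightarrow> ('x \<Rightarrow> real) \<Rightarrow> 'x \<Rightarrow> 'x \<Rightarrow> bool" where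
  "mm_update \<X> f s z z' \<longleftrightarrow> surrogate_at \<X> f s z \<and> z' \<in> argmax_set s \<X>"

definition mm_iteration ::
  "'x set \<Rightarrow> ('x \<Rightarrow> real) \<Rightarrow> ('x \<Rightarrow> 'x \<Rightarrow> real) \<Rightarrow> (nat \<Rightarrow> 'x) \<Rightarrow> bool" where
  "mm_iteration \<X> f L x \<longleftrightarrow> (\<forall>t. mm_update \<X> f (\<lambda>y. L y (x t)) (x t) (x (Suc t)))"

end

(* A joint maximizer (a, b) of g at z can be replaced by (U z, b), because U z is optimal against every b;
   optimizing over b afterwards loses nothing, so one sweep over u and v reaches the joint maximum f z.
   A single surrogate L must also cope with sequences that revisit a point z with different
   choices of v: there L y z = min (f y) (f z) works, since the iteration never decreases f. *)

theory Submission
  imports Defs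
begin

lemma argmax_set_iff: "a \<in> argmax_set h S \<longleftrightarrow> a \<in> S \<and> (\<forall>b \<in> S. h b \<le> h a)"
  by (auto simp: argmax_set_def is_arg_max_def not_less)

lemma has_max_iff: "has_max h S m \<longleftrightarrow> (\<exists>a \<in> S. h a = m) \<and> (\<forall>b \<in> S. h b \<le> m)"
  by (fastforce simp: has_max_def argmax_set_iff)

lemma argmax_set_if_value_eq_max:
  assumes "has_max h S m" "a \<in> S" "h a = m"
  shows "a \<in> argmax_set h S"
  using assms by (simp add: argmax_set_iff has_max_iff)

lemma sequential_max_is_joint_max:
  assumes max: "has_max (\<lambda>(a, b). h a b) (A \<times> B) m"
    and a: "\<And>b. b \<in> B \<Longrightarrow> a \<in> argmax_set (\<lambda>a. h a b) A"
    and b: "b \<in> argmax_set (h a) B"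
  shows "a \<in> A" "b \<in> B" "h a b = m"
proof -
  show bB: "b \<in> B" using b by (simp add: argmax_set_iff)
  show aA: "a \<in> A" using a[OF bB] by (simp add: argmax_set_iff)
  obtain a' b' where ab': "a' \<in> A" "b' \<in> B" "h a' b' = m"
    using max by (auto simp: has_max_iff)
  \<comment> \<open>Optimality of \<open>a\<close> is used here at the second coordinate of an
    unknown joint maximizer; this is why it is assumed against every element of
    \<open>B\<close>.\<close>
  have "m \<le> h a b'" using a[OF ab'(2)] ab' by (auto simp: argmax_set_iff)
  also have "\<dots> \<le> h a b" using b ab' by (simp add: argmax_set_iff)
  finally have "m \<le> h a b" .
  moreover have "h a b \<le> m" using max aA bB by (auto simp: has_max_iff)
  ultimately show "h a b = m" by simp
qed

text \<open>The sandwich f z = s z \<le> s z' \<le> f z': tangency at \<open>z\<close>, maximality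
  of \<open>z'\<close>, minorization at \<open>z'\<close>.\<close>

lemma mm_update_mono:
  assumes "mm_update X f s z z'" "z \<in> X"
  shows "f z \<le> f z'"
  using assms by (fastforce simp: mm_update_def surrogate_at_def argmax_set_iff)

text \<open>Capping \<open>f\<close> at the level \<open>f z\<close> makes every point of
  \<open>X\<close> with value at least \<open>f z\<close> a maximizer of the surrogate, in
  particular \<open>z'\<close>.\<close>

lemma mm_update_min:
  assumes "z' \<in> X" "f z \<le> f z'"
  shows "mm_update X f (\<lambda>y. min (f y) (f z)) z z'"
  using assms by (auto simp: mm_update_def surrogate_at_def argmax_set_iff)

text \<open>Passes from surrogates indexed by time to one indexed by the current point. Since
  capping \<open>f\<close> always yields some \<open>L\<close>, the second conclusion ties
  \<open>L\<close> to the given surrogates wherever all visits to a point agree.\<close>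

lemma mm_iteration_of_mm_updates:
  assumes step: "\<And>t. mm_update X f (s t) (x t) (x (Suc t))" and x0: "x 0 \<in> X"
  obtains L where "mm_iteration X f L x"
    and "\<And>t. (\<And>r. x r = x t \<Longrightarrow> s r = s t) \<Longrightarrow> (\<lambda>y. L y (x t)) = s t"
proof
  have xX: "x t \<in> X" for t
    using x0 step[of "t - 1"] by (cases t) (auto simp: mm_update_def argmax_set_iff)
  \<comment> \<open>At a visited point at most one \<open>h\<close> satisfies \<open>P\<close>, so
    \<open>THE\<close> is determined there. At unvisited points the value of \<open>L\<close> is
    irrelevant, as the iteration never reads it.\<close>
  define P where "P z h \<longleftrightarrow> (\<forall>r. x r = z \<longrightarrow> s r = h)" for z h
  define L where "L y z = (if \<exists>h. P z h then (THE h. P z h) y else min (f y) (f z))" for y z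
  have L_eq: "(\<lambda>y. L y (x t)) = s t" if "P (x t) h" for t h
  proof -
    have "(THE h. P (x t) h) = s t" using that by (intro the_equality) (auto simp: P_def)
    moreover have "\<exists>h. P (x t) h" using that by blast
    ultimately show ?thesis unfolding L_def by (simp only: if_True)
  qed
  show "mm_iteration X f L x"
    unfolding mm_iteration_def
  proof
    fix t
    show "mm_update X f (\<lambda>y. L y (x t)) (x t) (x (Suc t))"
    proof (cases "\<exists>h. P (x t) h")
      case True
      then obtain h where "P (x t) h" by blast
      then show ?thesis using step[of t] by (simp only: L_eq)
    next
      \<comment> \<open>Two visits to \<open>x t\<close> used different surrogates, so
        \<open>L\<close> is the capped \<open>f\<close>; the actual step supplies the required
        ascent.\<close>
      case False
      then show ?thesis
        using mm_update_min[where f = f, OF xX mm_update_mono[OF step xX]] by (simp add: L_def)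
    qed
  qed
  show "(\<lambda>y. L y (x t)) = s t" if "\<And>r. x r = x t \<Longrightarrow> s r = s t" for t
    using that by (intro L_eq[of _ "s t"]) (unfold P_def, blast)
qed

theorem mainTheorem4:
  fixes \<U> :: "'u set" and \<V> :: "'v set" and \<X> :: "'x set"
    and g :: "'u \<Rightarrow> 'v \<Rightarrow> 'x \<Rightarrow> real" and f :: "'x \<Rightarrow> real"
    and u :: "nat \<Rightarrow> 'u" and v :: "nat \<Rightarrow> 'v" and x :: "nat \<Rightarrow> 'x"
    and U :: "'x \<Rightarrow> 'u"
  assumes "\<U> \<noteq> {}" and "\<V> \<noteq> {}" and "\<X> \<noteq> {}"
    and f_max: "\<And>y. y \<in> \<X> \<Longrightarrow> has_max (\<lambda>(a, b). g a b y) (\<U> \<times> \<V>) (f y)"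
    and bca: "block_coordinate_ascent \<U> \<V> \<X> g u v x"
    and U_argmax: "\<And>b y. b \<in> \<V> \<Longrightarrow> y \<in> \<X> \<Longrightarrow> U y \<in> argmax_set (\<lambda>a. g a b y) \<U>"
    and u_update: "\<And>t. u (Suc t) = U (x t)"
  shows "(\<forall>t. (u (Suc t), v (Suc t)) \<in> argmax_set (\<lambda>(a, b). g a b (x t)) (\<U> \<times> \<V>) \<and>
              surrogate_at \<X> f (\<lambda>y. g (u (Suc t)) (v (Suc t)) y) (x t) \<and>
              mm_update \<X> f (\<lambda>y. g (u (Suc t)) (v (Suc t)) y) (x t) (x (Suc t))) \<and>
         (\<exists>L. mm_iteration \<X> f L x \<and>
              (\<forall>t. (\<forall>s. x s = x t \<longrightarrow> v (Suc s) = v (Suc t)) \<longrightarrow>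
                   (\<forall>y \<in> \<X>. L y (x t) = g (u (Suc t)) (v (Suc t)) y)))"
proof -
  have v_in: "v (Suc t) \<in> argmax_set (\<lambda>b. g (u (Suc t)) b (x t)) \<V>"
    and x_in: "x (Suc t) \<in> argmax_set (g (u (Suc t)) (v (Suc t))) \<X>" for t
    using bca by (auto simp: block_coordinate_ascent_def)
  have x0: "x 0 \<in> \<X>" using bca by (simp add: block_coordinate_ascent_def)
  have xX: "x t \<in> \<X>" for t
    using x0 x_in[of "t - 1"] by (cases t) (auto simp: argmax_set_iff)
  have joint: "u (Suc t) \<in> \<U>" "v (Suc t) \<in> \<V>" "g (u (Suc t)) (v (Suc t)) (x t) = f (x t)" for t
  proof -
    \<comment> \<open>The ascent iteration gives optimality of the u-block only against
      \<open>v t\<close>; \<open>U_argmax\<close> extends it to all of \<V>.\<close>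
    have "u (Suc t) \<in> argmax_set (\<lambda>a. g a b (x t)) \<U>" if "b \<in> \<V>" for b
      using U_argmax[OF that xX] by (simp add: u_update)
    note sequential_max_is_joint_max[OF f_max[OF xX], OF this v_in]
    then show "u (Suc t) \<in> \<U>" "v (Suc t) \<in> \<V>" "g (u (Suc t)) (v (Suc t)) (x t) = f (x t)"
      by simp_all
  qed
  have argmax: "(u (Suc t), v (Suc t)) \<in> argmax_set (\<lambda>(a, b). g a b (x t)) (\<U> \<times> \<V>)" for t
    by (rule argmax_set_if_value_eq_max[OF f_max[OF xX]]) (simp_all add: joint)
  have surrogate: "surrogate_at \<X> f (g (u (Suc t)) (v (Suc t))) (x t)" for t
    unfolding surrogate_at_def
  proof (intro conjI ballI joint)
    fix y assume "y \<in> \<X>"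
    then have "\<forall>(a, b) \<in> \<U> \<times> \<V>. g a b y \<le> f y"
      using f_max by (auto simp: has_max_iff)
    then show "g (u (Suc t)) (v (Suc t)) y \<le> f y" using joint(1,2) by blast
  qed
  have update: "mm_update \<X> f (g (u (Suc t)) (v (Suc t))) (x t) (x (Suc t))" for t
    using surrogate x_in by (simp add: mm_update_def)
  obtain L where L: "mm_iteration \<X> f L x"
    and L_eq: "\<And>t. (\<And>s. x s = x t \<Longrightarrow> g (u (Suc s)) (v (Suc s)) = g (u (Suc t)) (v (Suc t)))
      \<Longrightarrow> (\<lambda>y. L y (x t)) = g (u (Suc t)) (v (Suc t))"
    using mm_iteration_of_mm_updates[where s = "\<lambda>t. g (u (Suc t)) (v (Suc t))", OF update x0] by blast
  \<comment> \<open>Equal points have equal u-blocks by \<open>u_update\<close>, so agreement of the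
    v-blocks already makes the surrogates agree.\<close>
  have "L y (x t) = g (u (Suc t)) (v (Suc t)) y"
    if "\<forall>s. x s = x t \<longrightarrow> v (Suc s) = v (Suc t)" for t y
    by (rule fun_cong[OF L_eq]) (metis that u_update)
  then show ?thesis
    by (intro conjI allI exI[of _ L] impI ballI argmax surrogate update L)
qed

end
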